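(* For every $n\ge3$ and every $\boldsymbol\xi\in\mathbb R^n$, the products $\mathcal T1_i^0,\mathcal T2_i^0$ of the context satisfy $$\frac{\partial\mathcal T2_i^0}{\partial x_i}=\frac{\partial\mathcal T1_{i-1}^0}{\partial x_{i-1}},\qquad i=1,\dots,n\quad(\text{indices modulo }n).$$ Consequently the field $\boldsymbol v^0$ with $v_i^0=v_r(\mathcal T1_i^0-\mathcal T2_i^0)$ satisfies $\nabla\cdot\boldsymbol v^0=0$ identically, for every choice of phase angles.
   Context: Fix $\alpha>0$, $v_r>0$. For an integer $m$ put $\langle m\rangle=((m-1)\bmod n)+1\in\{1,\dots,n\}$. For $\boldsymbol x\in\mathbb R^n$, $\boldsymbol\xi=(\xi_1,\dots,\xi_n)$ and $i=1,\dots,n$, $$\mathcal T1_i^0=\prod_{k=1}^{n}\tau_k(\alpha x_{\langle i+k-1\rangle}+\xi_k),\quad\tau_k=\sin\ (k\text{ odd}),\ \tau_k=\cos\ (k\text{ even}),$$ $$\mathcal T2_i^0=\sin(\alpha x_{\langle i\rangle}+\xi_2)\prod_{k=2}^{n-1}\sigma_k(\alpha x_{\langle i+k-1\rangle}+\xi_{k+1})\,\cos(\alpha x_{\langle i+n-1\rangle}+\xi_1),\quad\sigma_k=\cos\ (k\text{ odd}),\ \sigma_k=\sin\ (k\text{ even}).$$ *)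

theory Defs
  imports "HOL-Analysis.Analysis"
begin

text \<open>
  Points of \<open>\<real>\<^sup>n\<close> and phase vectors are functions of type \<^typ>\<open>nat \<Rightarrow> real\<close>, of which
  only the coordinates with index in \<open>{1..n}\<close> are ever read. This keeps \<open>n\<close> a variable of the
  logic and makes the cyclic arithmetic on indices explicit.
\<close>

definition cyc :: "nat \<Rightarrow> int \<Rightarrow> nat" where
  "cyc n m = nat ((m - 1) mod int n) + 1"

definition tau :: "nat \<Rightarrow> real \<Rightarrow> real" where
  "tau k = (if odd k then sin else cos)"

definition sigma :: "nat \<Rightarrow> real \<Rightarrow> real" where
  "sigma k = (if odd k then cos else sin)"

definition T1 :: "nat \<Rightarrow> real \<Rightarrow> (nat \<Rightarrow> real) \<Rightarrow> nat \<Rightarrow> (nat \<Rightarrow> real) \<Rightarrow> real" where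
  "T1 n \<alpha> \<xi> i x = (\<Prod>k = 1..n. tau k (\<alpha> * x (cyc n (int i + int k - 1)) + \<xi> k))"

definition T2 :: "nat \<Rightarrow> real \<Rightarrow> (nat \<Rightarrow> real) \<Rightarrow> nat \<Rightarrow> (nat \<Rightarrow> real) \<Rightarrow> real" where
  "T2 n \<alpha> \<xi> i x =
     sin (\<alpha> * x (cyc n (int i)) + \<xi> 2)
     * (\<Prod>k = 2..n - 1. sigma k (\<alpha> * x (cyc n (int i + int k - 1)) + \<xi> (k + 1)))
     * cos (\<alpha> * x (cyc n (int i + int n - 1)) + \<xi> 1)"

definition v0 :: "nat \<Rightarrow> real \<Rightarrow> real \<Rightarrow> (nat \<Rightarrow> real) \<Rightarrow> (nat \<Rightarrow> real) \<Rightarrow> nat \<Rightarrow> real" where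
  "v0 n \<alpha> v\<^sub>r \<xi> x i = v\<^sub>r * (T1 n \<alpha> \<xi> i x - T2 n \<alpha> \<xi> i x)"

definition partially_differentiable ::
    "nat \<Rightarrow> ((nat \<Rightarrow> real) \<Rightarrow> real) \<Rightarrow> (nat \<Rightarrow> real) \<Rightarrow> bool" where
  "partially_differentiable j f x \<longleftrightarrow> (\<lambda>t. f (x(j := t))) field_differentiable (at (x j))"

text \<open>
  \<^const>\<open>deriv\<close> is total, so the value below is meaningful only where
  \<^const>\<open>partially_differentiable\<close> holds.
\<close>

definition partial_deriv ::
    "nat \<Rightarrow> ((nat \<Rightarrow> real) \<Rightarrow> real) \<Rightarrow> (nat \<Rightarrow> real) \<Rightarrow> real" where
  "partial_deriv j f x = deriv (\<lambda>t. f (x(j := t))) (x j)"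

definition divergence ::
    "nat \<Rightarrow> ((nat \<Rightarrow> real) \<Rightarrow> nat \<Rightarrow> real) \<Rightarrow> (nat \<Rightarrow> real) \<Rightarrow> real" where
  "divergence n v x = (\<Sum>i = 1..n. partial_deriv i (\<lambda>y. v y i) x)"

end

theory Submission
  imports Defs
begin

text \<open>
  Write \<open>a = \<alpha> x\<^bsub>i-1\<^esub> + \<xi>\<^sub>1\<close> and \<open>b = \<alpha> x\<^sub>i + \<xi>\<^sub>2\<close>, with indices modulo \<open>n\<close>. The phases of the two
  families are arranged so that \<open>\<T>1\<^bsub>i-1\<^esub> = sin a \<cdot> cos b \<cdot> Q\<close> and \<open>\<T>2\<^sub>i = cos a \<cdot> sin b \<cdot> Q\<close> with one and
  the same factor \<open>Q\<close> (\<open>common_tail\<close> below): shifting the product index by one turns \<open>\<sigma>\<^sub>k\<close> into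
  \<open>\<tau>\<^bsub>k+1\<^esub>\<close>. As the factors of these products read pairwise distinct coordinates, \<open>Q\<close> depends on
  neither \<open>x\<^bsub>i-1\<^esub>\<close> nor \<open>x\<^sub>i\<close>. In the variable it is differentiated by, each product is therefore
  a constant times the sine of an affine function, and both derivatives equal \<open>\<alpha> \<cdot> cos a \<cdot> cos b \<cdot> Q\<close>.

  The divergence is \<open>v\<^sub>r\<close> times \<open>\<Sum>\<^sub>i \<partial>\<^sub>i\<T>1\<^sub>i - \<Sum>\<^sub>i \<partial>\<^sub>i\<T>2\<^sub>i\<close>. The cyclic predecessor permutes the indices,
  so the first sum may be taken over \<open>i - 1\<close> instead of \<open>i\<close>, and then the two agree term by term.
\<close>

lemma cyc_eq_iff:
  assumes "n > 0"
  shows "cyc n a = cyc n b \<longleftrightarrow> int n dvd a - b"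
proof -
  have "cyc n a = cyc n b \<longleftrightarrow> (a - 1) mod int n = (b - 1) mod int n"
    using assms by (simp add: cyc_def nat_eq_iff)
  then show ?thesis
    by (simp add: mod_eq_dvd_iff)
qed

lemma cyc_in_range: "n > 0 \<Longrightarrow> cyc n m \<in> {1..n}"
  using pos_mod_bound[of "int n" "m - 1"] pos_mod_sign[of "int n" "m - 1"]
  unfolding cyc_def atLeastAtMost_iff by linarith

lemma cyc_of_index: "i \<in> {1..n} \<Longrightarrow> cyc n (int i) = i"
  by (auto simp: cyc_def)

lemma int_cyc_dvd: "n > 0 \<Longrightarrow> int n dvd int (cyc n m) - m"
  using cyc_eq_iff[of n "int (cyc n m)" m] cyc_of_index[OF cyc_in_range] by simp

lemma cyc_cyc_add:
  assumes "n > 0"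
  shows "cyc n (int (cyc n m) + d) = cyc n (m + d)"
  using int_cyc_dvd[OF assms, of m] by (simp add: cyc_eq_iff[OF assms])

lemma cyc_add_neq:
  assumes "0 < d" and "d < int n"
  shows "cyc n (m + d) \<noteq> cyc n m"
  using assms zdvd_not_zless[of d "int n"] by (simp add: cyc_eq_iff)

lemma bij_betw_cyc_pred:
  assumes "n > 0"
  shows "bij_betw (\<lambda>i. cyc n (int i - 1)) {1..n} {1..n}"
proof -
  have "inj_on (\<lambda>i. cyc n (int i - 1)) {1..n}"
  proof (rule inj_onI)
    fix i j
    assume "i \<in> {1..n}" "j \<in> {1..n}" "cyc n (int i - 1) = cyc n (int j - 1)"
    then have "cyc n (int i) = cyc n (int j)"
      using assms by (simp add: cyc_eq_iff)
    with \<open>i \<in> {1..n}\<close> \<open>j \<in> {1..n}\<close> show "i = j"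
      by (simp add: cyc_of_index)
  qed
  moreover have "(\<lambda>i. cyc n (int i - 1)) ` {1..n} \<subseteq> {1..n}"
    using cyc_in_range[OF assms] by blast
  ultimately show ?thesis
    by (simp add: bij_betw_def endo_inj_surj)
qed

definition common_tail :: "nat \<Rightarrow> real \<Rightarrow> (nat \<Rightarrow> real) \<Rightarrow> nat \<Rightarrow> (nat \<Rightarrow> real) \<Rightarrow> real" where
  "common_tail n \<alpha> \<xi> i x = (\<Prod>k = 3..n. tau k (\<alpha> * x (cyc n (int i + int k - 2)) + \<xi> k))"

text \<open>
  The offsets \<open>k - 2\<close> with \<open>3 \<le> k \<le> n\<close> run through \<open>1, \<dots>, n - 2\<close>, so the cycle never returns to
  \<open>i\<close> and stops one step short of its predecessor.
\<close>

lemma common_tail_upd: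
  assumes "j = cyc n (int i) \<or> j = cyc n (int i - 1)"
  shows "common_tail n \<alpha> \<xi> i (x(j := t)) = common_tail n \<alpha> \<xi> i x"
  unfolding common_tail_def
proof (rule prod.cong[OF refl])
  fix k
  assume "k \<in> {3..n}"
  then have "cyc n (int i + int k - 2) \<noteq> cyc n (int i)"
    and "cyc n (int i + int k - 2) \<noteq> cyc n (int i - 1)"
    using cyc_add_neq[of "int k - 2" n "int i"] cyc_add_neq[of "int k - 1" n "int i - 1"]
    by (auto simp: algebra_simps)
  then show "tau k (\<alpha> * (x(j := t)) (cyc n (int i + int k - 2)) + \<xi> k)
      = tau k (\<alpha> * x (cyc n (int i + int k - 2)) + \<xi> k)"
    using assms by auto
qed

lemma T1_pred_factorisation:
  assumes "n \<ge> 3"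
  shows "T1 n \<alpha> \<xi> (cyc n (int i - 1)) x
    = sin (\<alpha> * x (cyc n (int i - 1)) + \<xi> 1)
      * (cos (\<alpha> * x (cyc n (int i)) + \<xi> 2) * common_tail n \<alpha> \<xi> i x)"
proof -
  let ?f = "\<lambda>k. tau k (\<alpha> * x (cyc n (int i + int k - 2)) + \<xi> k)"
  have "cyc n (int (cyc n (int i - 1)) + int k - 1) = cyc n (int i + int k - 2)" for k
    using cyc_cyc_add[of n "int i - 1" "int k - 1"] assms by (simp add: algebra_simps)
  then have "T1 n \<alpha> \<xi> (cyc n (int i - 1)) x = (\<Prod>k = 1..n. ?f k)"
    by (simp add: T1_def)
  also have "\<dots> = ?f 1 * (?f 2 * (\<Prod>k = 3..n. ?f k))"
    using assms by (simp add: prod.atLeast_Suc_atMost numeral_eq_Suc)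
  finally show ?thesis
    by (simp add: common_tail_def tau_def)
qed

text \<open>
  Offset \<open>n - 1\<close> is offset \<open>-1\<close> modulo \<open>n\<close>, so the closing cosine of \<open>\<T>2\<^sub>i\<close> reads \<open>x\<^bsub>i-1\<^esub>\<close>, the coordinate
  with which \<open>\<T>1\<^bsub>i-1\<^esub>\<close> begins.
\<close>

lemma T2_factorisation:
  assumes "n \<ge> 3"
  shows "T2 n \<alpha> \<xi> i x
    = sin (\<alpha> * x (cyc n (int i)) + \<xi> 2)
      * (cos (\<alpha> * x (cyc n (int i - 1)) + \<xi> 1) * common_tail n \<alpha> \<xi> i x)"
proof -
  have "sigma k = tau (Suc k)" for k
    by (simp add: sigma_def tau_def)
  then have "common_tail n \<alpha> \<xi> i x
      = (\<Prod>k = 2..n - 1. sigma k (\<alpha> * x (cyc n (int i + int k - 1)) + \<xi> (k + 1)))"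
    unfolding common_tail_def
    using prod.shift_bounds_cl_Suc_ivl[of
        "\<lambda>k. tau k (\<alpha> * x (cyc n (int i + int k - 2)) + \<xi> k)" 2 "n - 1"] assms
    by (simp add: algebra_simps)
  moreover have "cyc n (int i + int n - 1) = cyc n (int i - 1)"
    using assms by (simp add: cyc_eq_iff)
  ultimately show ?thesis
    by (simp add: T2_def)
qed

lemma has_field_derivative_affine_sin:
  fixes a b c t :: real
  shows "((\<lambda>t. sin (a * t + b) * c) has_field_derivative a * cos (a * t + b) * c) (at t)"
  by (auto intro!: derivative_eq_intros)

definition common_deriv :: "nat \<Rightarrow> real \<Rightarrow> (nat \<Rightarrow> real) \<Rightarrow> nat \<Rightarrow> (nat \<Rightarrow> real) \<Rightarrow> real" where
  "common_deriv n \<alpha> \<xi> i x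
    = \<alpha> * cos (\<alpha> * x (cyc n (int i - 1)) + \<xi> 1) * cos (\<alpha> * x (cyc n (int i)) + \<xi> 2)
      * common_tail n \<alpha> \<xi> i x"

lemma cyc_neq_pred: "n \<ge> 3 \<Longrightarrow> cyc n (int i) \<noteq> cyc n (int i - 1)"
  using cyc_add_neq[of 1 n "int i - 1"] by simp

lemma T1_pred_has_derivative:
  fixes x :: "nat \<Rightarrow> real" and i :: nat
  assumes "n \<ge> 3"
  defines "j \<equiv> cyc n (int i - 1)"
  shows "((\<lambda>t. T1 n \<alpha> \<xi> j (x(j := t))) has_field_derivative common_deriv n \<alpha> \<xi> i x) (at (x j))"
proof -
  let ?c = "cos (\<alpha> * x (cyc n (int i)) + \<xi> 2) * common_tail n \<alpha> \<xi> i x"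
  have "T1 n \<alpha> \<xi> j (x(j := t)) = sin (\<alpha> * t + \<xi> 1) * ?c" for t
    using T1_pred_factorisation[OF assms(1)] cyc_neq_pred[OF assms(1)]
    by (simp add: j_def common_tail_upd)
  then show ?thesis
    using has_field_derivative_affine_sin[of \<alpha> "\<xi> 1" ?c "x j"]
    by (simp add: common_deriv_def j_def mult_ac)
qed

lemma T2_has_derivative:
  fixes x :: "nat \<Rightarrow> real"
  assumes "n \<ge> 3" and "i \<in> {1..n}"
  shows "((\<lambda>t. T2 n \<alpha> \<xi> i (x(i := t))) has_field_derivative common_deriv n \<alpha> \<xi> i x) (at (x i))"
proof -
  let ?c = "cos (\<alpha> * x (cyc n (int i - 1)) + \<xi> 1) * common_tail n \<alpha> \<xi> i x"
  have i: "cyc n (int i) = i"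
    using assms(2) by (rule cyc_of_index)
  have "T2 n \<alpha> \<xi> i (x(i := t)) = sin (\<alpha> * t + \<xi> 2) * ?c" for t
    using T2_factorisation[OF assms(1)] cyc_neq_pred[OF assms(1), of i]
    by (simp add: i common_tail_upd)
  then show ?thesis
    using has_field_derivative_affine_sin[of \<alpha> "\<xi> 2" ?c "x i"]
    by (simp add: common_deriv_def i mult_ac)
qed

lemma has_derivative_imp_partial:
  assumes "((\<lambda>t. f (x(j := t))) has_field_derivative D) (at (x j))"
  shows "partially_differentiable j f x" and "partial_deriv j f x = D"
  using assms
  by (auto simp: partially_differentiable_def partial_deriv_def field_differentiable_def
      intro: DERIV_imp_deriv)

lemma partial_scaled_diff:
  assumes "partially_differentiable j f x" and "partially_differentiable j g x"
  shows "partially_differentiable j (\<lambda>y. c * (f y - g y)) x"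
    and "partial_deriv j (\<lambda>y. c * (f y - g y)) x = c * (partial_deriv j f x - partial_deriv j g x)"
proof -
  have "((\<lambda>t. c * (f (x(j := t)) - g (x(j := t)))) has_field_derivative
      c * (partial_deriv j f x - partial_deriv j g x)) (at (x j))"
    using assms unfolding partially_differentiable_def partial_deriv_def
    by (intro DERIV_cmult DERIV_diff field_differentiable_derivI)
  then show "partially_differentiable j (\<lambda>y. c * (f y - g y)) x"
    and "partial_deriv j (\<lambda>y. c * (f y - g y)) x = c * (partial_deriv j f x - partial_deriv j g x)"
    by (rule has_derivative_imp_partial)+
qed

theorem lemma3p1:
  fixes \<alpha> v\<^sub>r :: real and n :: nat and \<xi> :: "nat \<Rightarrow> real"
  assumes "\<alpha> > 0" and "v\<^sub>r > 0" and "n \<ge> 3"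
  shows "(\<forall>x :: nat \<Rightarrow> real. \<forall>i\<in>{1..n}.
            partially_differentiable i (T2 n \<alpha> \<xi> i) x
          \<and> partially_differentiable (cyc n (int i - 1)) (T1 n \<alpha> \<xi> (cyc n (int i - 1))) x
          \<and> partial_deriv i (T2 n \<alpha> \<xi> i) x
            = partial_deriv (cyc n (int i - 1)) (T1 n \<alpha> \<xi> (cyc n (int i - 1))) x)
       \<and> (\<forall>x :: nat \<Rightarrow> real.
            (\<forall>i\<in>{1..n}. partially_differentiable i (\<lambda>y. v0 n \<alpha> v\<^sub>r \<xi> y i) x)
          \<and> divergence n (v0 n \<alpha> v\<^sub>r \<xi>) x = 0)"
proof -
  let ?p = "\<lambda>i. cyc n (int i - 1)"
  have bij: "bij_betw ?p {1..n} {1..n}"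
    using assms(3) by (intro bij_betw_cyc_pred) simp
  have T1_partial: "partially_differentiable (?p i) (T1 n \<alpha> \<xi> (?p i)) x"
    "partial_deriv (?p i) (T1 n \<alpha> \<xi> (?p i)) x = common_deriv n \<alpha> \<xi> i x" for i x
    by (rule has_derivative_imp_partial, rule T1_pred_has_derivative[OF assms(3)])+
  have T2_partial: "partially_differentiable i (T2 n \<alpha> \<xi> i) x"
    "partial_deriv i (T2 n \<alpha> \<xi> i) x = common_deriv n \<alpha> \<xi> i x" if "i \<in> {1..n}" for i x
    by (rule has_derivative_imp_partial, rule T2_has_derivative[OF assms(3) that])+
  have T1_diff: "partially_differentiable j (T1 n \<alpha> \<xi> j) x" if "j \<in> {1..n}" for j x
  proof -
    have "j \<in> ?p ` {1..n}"
      using that by (simp only: bij_betw_imp_surj_on[OF bij])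
    then obtain i where "j = ?p i"
      by (rule imageE)
    then show ?thesis
      by (simp only: T1_partial(1))
  qed
  have v0_diff: "partially_differentiable i (\<lambda>y. v0 n \<alpha> v\<^sub>r \<xi> y i) x" if "i \<in> {1..n}" for i x
    unfolding v0_def by (intro partial_scaled_diff(1) T1_diff T2_partial(1) that)
  have div0: "divergence n (v0 n \<alpha> v\<^sub>r \<xi>) x = 0" for x
  proof -
    have "(\<Sum>i = 1..n. partial_deriv i (T1 n \<alpha> \<xi> i) x)
        = (\<Sum>i = 1..n. partial_deriv (?p i) (T1 n \<alpha> \<xi> (?p i)) x)"
      using sum.reindex_bij_betw[OF bij, of "\<lambda>j. partial_deriv j (T1 n \<alpha> \<xi> j) x"] by (rule sym)
    also have "\<dots> = (\<Sum>i = 1..n. partial_deriv i (T2 n \<alpha> \<xi> i) x)"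
      by (rule sum.cong) (simp_all only: T1_partial(2) T2_partial(2))
    finally have sums: "(\<Sum>i = 1..n. partial_deriv i (T1 n \<alpha> \<xi> i) x)
        = (\<Sum>i = 1..n. partial_deriv i (T2 n \<alpha> \<xi> i) x)" .
    have "divergence n (v0 n \<alpha> v\<^sub>r \<xi>) x
        = (\<Sum>i = 1..n. v\<^sub>r * (partial_deriv i (T1 n \<alpha> \<xi> i) x - partial_deriv i (T2 n \<alpha> \<xi> i) x))"
      unfolding divergence_def v0_def
      by (intro sum.cong refl partial_scaled_diff(2) T1_diff T2_partial(1))
    also have "\<dots> = 0"
      using sums by (simp only: sum_distrib_left[symmetric] sum_subtractf) simp
    finally show ?thesis .
  qed
  show ?thesis
  proof (intro conjI allI ballI)
    fix x :: "nat \<Rightarrow> real" and i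
    assume "i \<in> {1..n}"
    then show "partial_deriv i (T2 n \<alpha> \<xi> i) x = partial_deriv (?p i) (T1 n \<alpha> \<xi> (?p i)) x"
      by (simp only: T1_partial(2) T2_partial(2))
  qed (simp_all only: T1_partial(1) T2_partial(1) v0_diff div0)
qed

end
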